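(* Let $r$, $c$, $d$ and $k$ be continuous real-valued functions on the interval $[a,b]$, with $d,k\ge 0$, and let $\alpha\in(0,1]$, such that $$r(t)\le c(t)+d(t)\,J_{T,a}^{\alpha}(kr)(t)\qquad\text{for all } t\in[a,b].$$ Then $$r(t)\le c(t)+d(t)\,J_{T,a}^{\alpha}\big(c\,k\,e^{-J_{T,a}^{\alpha}(dk)}\big)(t)\,e^{J_{T,a}^{\alpha}(dk)(t)}\qquad\text{for every } t\in[a,b].$$
   Context: $T(t,\alpha)$ is a given kernel: for the fixed $\alpha$, $t\mapsto T(t,\alpha)$ is a positive continuous function on $[a,b]$. For a locally integrable function $f$, the integral operator is $$J_{T,a}^{\alpha}(f)(t)=\int_a^t\frac{f(\omega)}{T(\omega,\alpha)}\,d\omega .$$ The expression $e^{-J_{T,a}^{\alpha}(dk)}$ denotes the function $s\mapsto e^{-J_{T,a}^{\alpha}(dk)(s)}$. *)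

theory Defs
  imports "HOL-Analysis.Analysis"
begin

(* The Lebesgue integral of f(w) / T(w, alpha) over the oriented interval from a to t.
   As usual for the Bochner integral, the value is 0 when the integrand is not integrable;
   for f and T continuous on [a,b] with T > 0 there, and t in [a,b], this does not occur. *)
definition J_op :: "(real \<Rightarrow> real \<Rightarrow> real) \<Rightarrow> real \<Rightarrow> real \<Rightarrow> (real \<Rightarrow> real) \<Rightarrow> real \<Rightarrow> real" where
  "J_op T a \<alpha> f t = (LBINT \<omega>=a..t. f \<omega> / T \<omega> \<alpha>)"

end

theory Submission
  imports Defs
begin

text \<open>
  Gronwall's argument with an integrating factor: write R, P and F for the operator applied to
  k r, to d k and to c k exp (- P). The function R exp (- P) - F vanishes at a, and its derivative
  is (k / T) exp (- P) (r - c - d R), which is nonpositive by the hypothesis. Hence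
  R \<le> F exp P, and the claim follows because d is nonnegative.
\<close>

text \<open>The fundamental theorem of calculus is available for the gauge integral
  \<open>integral\<close>. A continuous integrand on a compact interval is Lebesgue integrable, so
  both integrals agree there and the derivative carries over, one-sided at the endpoints.\<close>

lemma J_op_has_real_derivative:
  assumes T: "continuous_on {a..b} (\<lambda>t. T t \<alpha>)" "\<And>t. t \<in> {a..b} \<Longrightarrow> T t \<alpha> \<noteq> 0"
    and f: "continuous_on {a..b} f"
    and t: "t \<in> {a..b}"
  shows "(J_op T a \<alpha> f has_real_derivative f t / T t \<alpha>) (at t within {a..b})"
proof -
  have cont: "continuous_on {a..b} (\<lambda>s. f s / T s \<alpha>)"
    using T f by (intro continuous_on_divide) auto
  have eq: "integral {a..x} (\<lambda>s. f s / T s \<alpha>) = J_op T a \<alpha> f x" if "x \<in> {a..b}" for x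
    unfolding J_op_def using that
    by (intro interval_integral_eq_integral [symmetric] borel_integrable_atLeastAtMost'
        continuous_on_subset [OF cont]) auto
  show ?thesis
    \<comment> \<open>The radius 1 is arbitrary: the two functions agree on all of
      \<open>{a..b}\<close>.\<close>
    by (rule has_field_derivative_transform_within
          [OF integral_has_real_derivative [OF cont t] zero_less_one t]) (simp add: eq)
qed

lemma J_op_continuous_on:
  assumes "continuous_on {a..b} (\<lambda>t. T t \<alpha>)" "\<And>t. t \<in> {a..b} \<Longrightarrow> T t \<alpha> \<noteq> 0"
    and "continuous_on {a..b} f"
  shows "continuous_on {a..b} (J_op T a \<alpha> f)"
  using J_op_has_real_derivative [where T = T, OF assms] by (rule DERIV_continuous_on)

lemma J_op_self [simp]: "J_op T a \<alpha> f a = 0"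
  by (simp add: J_op_def)

theorem theorem12:
  fixes T :: "real \<Rightarrow> real \<Rightarrow> real"
    and r c d k :: "real \<Rightarrow> real"
    and a b \<alpha> :: real
  assumes "a \<le> b"
    and "0 < \<alpha>" and "\<alpha> \<le> 1"
    and "continuous_on {a..b} (\<lambda>t. T t \<alpha>)"
    and "\<And>t. t \<in> {a..b} \<Longrightarrow> 0 < T t \<alpha>"
    and "continuous_on {a..b} r"
    and "continuous_on {a..b} c"
    and "continuous_on {a..b} d"
    and "continuous_on {a..b} k"
    and "\<And>t. t \<in> {a..b} \<Longrightarrow> 0 \<le> d t"
    and "\<And>t. t \<in> {a..b} \<Longrightarrow> 0 \<le> k t"
    and "\<And>t. t \<in> {a..b} \<Longrightarrow> r t \<le> c t + d t * J_op T a \<alpha> (\<lambda>s. k s * r s) t"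
  shows "\<forall>t\<in>{a..b}. r t \<le> c t
           + d t * J_op T a \<alpha> (\<lambda>s. c s * k s * exp (- J_op T a \<alpha> (\<lambda>u. d u * k u) s)) t
             * exp (J_op T a \<alpha> (\<lambda>u. d u * k u) t)"
proof
  fix t assume t: "t \<in> {a..b}"
  note T_cont = assms(4) and T_pos = assms(5) and cont = assms(6-9)
  have T_nz: "T s \<alpha> \<noteq> 0" if "s \<in> {a..b}" for s
    using T_pos [OF that] by simp
  have deriv: "(J_op T a \<alpha> f has_real_derivative f s / T s \<alpha>) (at s within {a..b})"
    if "s \<in> {a..b}" "continuous_on {a..b} f" for f s
    using T_cont T_nz that(2,1) by (rule J_op_has_real_derivative)
  define R where "R = J_op T a \<alpha> (\<lambda>s. k s * r s)"
  define P where "P = J_op T a \<alpha> (\<lambda>u. d u * k u)"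
  define F where "F = J_op T a \<alpha> (\<lambda>s. c s * k s * exp (- P s))"
  define G where "G = (\<lambda>s. R s * exp (- P s) - F s)"
  define G' where "G' = (\<lambda>s. k s / T s \<alpha> * exp (- P s) * (r s - (c s + d s * R s)))"
  \<comment> \<open>The integrand of \<open>F\<close> contains \<open>P\<close>, so \<open>F\<close>
    can be differentiated only once \<open>P\<close> is known to be continuous.\<close>
  have P_cont: "continuous_on {a..b} P"
    unfolding P_def by (intro J_op_continuous_on T_cont T_nz continuous_intros cont)
  have R': "(R has_real_derivative k s * r s / T s \<alpha>) (at s within {a..b})"
    if "s \<in> {a..b}" for s
    unfolding R_def by (rule deriv [OF that]) (intro continuous_intros cont)
  have P': "(P has_real_derivative d s * k s / T s \<alpha>) (at s within {a..b})"
    if "s \<in> {a..b}" for s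
    unfolding P_def by (rule deriv [OF that]) (intro continuous_intros cont)
  have F': "(F has_real_derivative c s * k s * exp (- P s) / T s \<alpha>) (at s within {a..b})"
    if "s \<in> {a..b}" for s
    unfolding F_def by (rule deriv [OF that]) (intro continuous_intros cont P_cont)
  \<comment> \<open>The product rule gives three terms with the common factor
    \<open>k s / T s \<alpha> * exp (- P s)\<close>; what remains is the slack in the hypothesis at
    \<open>s\<close>.\<close>
  have G': "(G has_real_derivative G' s) (at s within {a..b})" if s: "s \<in> {a..b}" for s
    unfolding G_def
    by (rule derivative_eq_intros R' [OF s] P' [OF s] F' [OF s] refl)+
       (simp add: G'_def algebra_simps diff_divide_distrib add_divide_distrib)
  have G'_nonpos: "G' s \<le> 0" if "s \<in> {a..b}" for s
    unfolding G'_def using that T_pos assms(11,12)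
    by (intro mult_nonneg_nonpos mult_nonneg_nonneg divide_nonneg_pos) (auto simp: R_def)
  \<comment> \<open>The derivatives are taken within \<open>{a..b}\<close> and are two-sided only at
    interior points. This form of the monotonicity criterion asks for no more than that, together
    with continuity up to the endpoints.\<close>
  have "G t \<le> G a"
  proof (rule DERIV_nonpos_imp_decreasing_open [where f = G])
    show "a \<le> t" using t by simp
    have "continuous_on {a..b} G"
      using G' by (rule DERIV_continuous_on)
    then show "continuous_on {a..t} G"
      by (rule continuous_on_subset) (use t in auto)
    fix s assume "a < s" "s < t"
    with t have s: "a < s" "s < b" by auto
    then have "(G has_real_derivative G' s) (at s)"
      using G' [of s] by (simp add: at_within_Icc_at)
    with s show "\<exists>y. (G has_real_derivative y) (at s) \<and> y \<le> 0"
      using G'_nonpos [of s] by auto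
  qed
  \<comment> \<open>Here \<open>G a = 0\<close>, since \<open>R\<close> and \<open>F\<close> are
    integrals starting at \<open>a\<close>.\<close>
  then have "R t * exp (- P t) \<le> F t"
    by (simp add: G_def R_def F_def)
  then have "R t \<le> F t * exp (P t)"
    by (simp add: exp_minus field_simps)
  \<comment> \<open>The sign of \<open>d\<close> enters here, and only at the point
    \<open>t\<close>.\<close>
  then have "d t * R t \<le> d t * F t * exp (P t)"
    using mult_left_mono [OF _ assms(10) [OF t]] by (simp add: mult.assoc)
  with assms(12) [OF t]
  show "r t \<le> c t
           + d t * J_op T a \<alpha> (\<lambda>s. c s * k s * exp (- J_op T a \<alpha> (\<lambda>u. d u * k u) s)) t
             * exp (J_op T a \<alpha> (\<lambda>u. d u * k u) t)"
    unfolding F_def P_def R_def by linarith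
qed

end
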